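(* Let $\rho>0$ and let $G$ be a locally integrable completely monotonic relaxation modulus with $G_\infty>0$, with associated dispersion-attenuation spectral measure $\nu$ and dispersion-attenuation function $\beta$. Put $$g(t)=\int_{(0,\infty)}e^{-rt}\,\nu(dr)\quad(t>0),\qquad f(t)=\int_0^t g(s)\,ds=\int_{(0,\infty)}\frac{1-e^{-tr}}{r}\,\nu(dr)\quad(t\ge0),$$ and $f(t)=0$ for $t<0$. Then $g$ is a locally integrable completely monotonic function, $f$ is a Bernstein function on $[0,\infty)$, continuous on $[0,\infty)$ with $f(0)=0$, and $\beta(p)$ is (for $\operatorname{Re}p>0$) the Laplace transform of the causal distribution $D^2f$, the second distributional derivative of $f$ on $\mathbb{R}$.
   Context: A function on $(0,\infty)$ is completely monotonic (CM) if it is infinitely differentiable and $(-1)^n f^{(n)}\ge0$ for all $n\ge0$; it is locally integrable if integrable over $[0,1]$. A Bernstein function is a function $f\ge0$ on $[0,\infty)$ whose derivative is CM on $(0,\infty)$. A distribution on $\mathbb{R}$ is causal if it is supported in $[0,\infty)$. For a locally integrable CM function $G$, $G_\infty:=\lim_{t\to\infty}G(t)$, $Q(p):=p\tilde G(p)$ where $\tilde G(p)=\int_0^\infty G(t)e^{-pt}dt$ (analytically continued to $\mathbb{C}\setminus(-\infty,0]$), and $\kappa(p):=\rho^{1/2}p/Q(p)^{1/2}$ with the branch positive for $p>0$. When $G_\infty>0$ there are a unique $B\ge0$ and a unique positive Radon measure $\nu$ on $(0,\infty)$ (the dispersion-attenuation spectral measure) with $\int_{(0,\infty)}\nu(dr)/(1+r)<\infty$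 such that $\kappa(p)=Bp+\beta(p)$, where $\beta(p)=p\int_{(0,\infty)}\nu(dr)/(p+r)$ is the dispersion-attenuation function. *)

theory Defs
  imports "HOL-Complex_Analysis.Complex_Analysis"
begin

section \<open>Completely monotonic and Bernstein functions\<close>

text \<open>Functions on \<open>(0,\<infinity>)\<close> and on \<open>[0,\<infinity>)\<close> are represented by total functions whose values
  elsewhere are ignored.\<close>

definition completely_monotonic :: "(real \<Rightarrow> real) \<Rightarrow> bool" where
  "completely_monotonic f \<longleftrightarrow>
     (\<forall>n. \<forall>t>0. (deriv ^^ n) f field_differentiable at t \<and> 0 \<le> (-1) ^ n * (deriv ^^ n) f t)"

text \<open>The endpoint 0 is a null set, and a function on \<open>(0,\<infinity>)\<close> has no value there.\<close>

definition locally_integrable :: "(real \<Rightarrow> real) \<Rightarrow> bool" where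
  "locally_integrable f \<longleftrightarrow> set_integrable lborel {0<..1} f"

definition bernstein :: "(real \<Rightarrow> real) \<Rightarrow> bool" where
  "bernstein f \<longleftrightarrow>
     (\<forall>t\<ge>0. 0 \<le> f t) \<and> (\<forall>t>0. f field_differentiable at t) \<and> completely_monotonic (deriv f)"


section \<open>Relaxation modulus, wave number and spectral measure\<close>

abbreviation cut_plane :: "complex set" where
  "cut_plane \<equiv> - \<real>\<^sub>\<le>\<^sub>0"

text \<open>The Laplace transform of \<open>G\<close>, continued analytically from the right half-plane. The
  continuation is unique on the cut plane, because that set is connected; values on the cut
  are irrelevant.\<close>

definition modulus_transform :: "(real \<Rightarrow> real) \<Rightarrow> complex \<Rightarrow> complex" where
  "modulus_transform G =
     (SOME F. F holomorphic_on cut_plane \<and>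
        (\<forall>p. 0 < Re p \<longrightarrow>
           F p = (\<integral>t\<in>{0<..}. complex_of_real (G t) * exp (- p * of_real t) \<partial>lborel)))"

definition Q_fun :: "(real \<Rightarrow> real) \<Rightarrow> complex \<Rightarrow> complex" where
  "Q_fun G p = p * modulus_transform G p"

text \<open>The holomorphic branch of \<open>Q\<^sup>1\<^sup>/\<^sup>2\<close> that is positive on the positive half-axis.\<close>

definition sqrt_Q :: "(real \<Rightarrow> real) \<Rightarrow> complex \<Rightarrow> complex" where
  "sqrt_Q G =
     (SOME s. s holomorphic_on cut_plane \<and> (\<forall>p\<in>cut_plane. (s p)\<^sup>2 = Q_fun G p) \<and>
        (\<forall>x>0. \<exists>y>0. s (complex_of_real x) = complex_of_real y))"

definition kappa :: "real \<Rightarrow> (real \<Rightarrow> real) \<Rightarrow> complex \<Rightarrow> complex" where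
  "kappa \<rho> G p = of_real (sqrt \<rho>) * p / sqrt_Q G p"

definition disp_atten_fun :: "real measure \<Rightarrow> complex \<Rightarrow> complex" where
  "disp_atten_fun \<nu> p = p * (\<integral>r. 1 / (p + of_real r) \<partial>\<nu>)"

text \<open>On \<open>(0,\<infinity>)\<close> a Borel measure that is finite on compact sets is automatically regular.\<close>

definition radon_on_pos :: "real measure \<Rightarrow> bool" where
  "radon_on_pos \<nu> \<longleftrightarrow>
     sets \<nu> = sets (restrict_space borel {0<..}) \<and>
     (\<forall>K. compact K \<and> K \<subseteq> {0<..} \<longrightarrow> emeasure \<nu> K < \<infinity>)"

definition disp_atten_spectral_measure ::
    "real \<Rightarrow> (real \<Rightarrow> real) \<Rightarrow> real measure \<Rightarrow> bool" where
  "disp_atten_spectral_measure \<rho> G \<nu> \<longleftrightarrow>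
     radon_on_pos \<nu> \<and> (\<integral>\<^sup>+ r. ennreal (1 / (1 + r)) \<partial>\<nu>) < \<infinity> \<and>
     (\<exists>B\<ge>0. \<forall>p\<in>cut_plane. kappa \<rho> G p = of_real B * p + disp_atten_fun \<nu> p)"

definition g_fun :: "real measure \<Rightarrow> real \<Rightarrow> real" where
  "g_fun \<nu> t = (\<integral>r. exp (- r * t) \<partial>\<nu>)"

definition f_fun :: "real measure \<Rightarrow> real \<Rightarrow> real" where
  "f_fun \<nu> t = (if t < 0 then 0 else (\<integral>s\<in>{0<..t}. g_fun \<nu> s \<partial>lborel))"


section \<open>Distributions on the real line\<close>

definition vderiv :: "(real \<Rightarrow> complex) \<Rightarrow> real \<Rightarrow> complex" where
  "vderiv \<phi> = (\<lambda>x. vector_derivative \<phi> (at x))"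

definition smooth_fun :: "(real \<Rightarrow> complex) \<Rightarrow> bool" where
  "smooth_fun \<phi> \<longleftrightarrow> (\<forall>n x. (vderiv ^^ n) \<phi> differentiable (at x))"

definition fun_support :: "(real \<Rightarrow> complex) \<Rightarrow> real set" where
  "fun_support \<phi> = closure {x. \<phi> x \<noteq> 0}"

definition test_funs :: "(real \<Rightarrow> complex) set" where
  "test_funs = {\<phi>. smooth_fun \<phi> \<and> compact (fun_support \<phi>)}"

definition schwartz_funs :: "(real \<Rightarrow> complex) set" where
  "schwartz_funs =
     {\<phi>. smooth_fun \<phi> \<and> (\<forall>j k. bounded (range (\<lambda>x. \<bar>x\<bar> ^ j * norm ((vderiv ^^ k) \<phi> x))))}"

definition linear_on_funs ::
    "(real \<Rightarrow> complex) set \<Rightarrow> ((real \<Rightarrow> complex) \<Rightarrow> complex) \<Rightarrow> bool" where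
  "linear_on_funs V T \<longleftrightarrow>
     (\<forall>\<phi>\<in>V. \<forall>\<psi>\<in>V. \<forall>c d. T (\<lambda>x. c * \<phi> x + d * \<psi> x) = c * T \<phi> + d * T \<psi>)"

text \<open>Continuity is expressed by the usual seminorm estimates.\<close>

definition is_distribution :: "((real \<Rightarrow> complex) \<Rightarrow> complex) \<Rightarrow> bool" where
  "is_distribution T \<longleftrightarrow> linear_on_funs test_funs T \<and>
     (\<forall>K. compact K \<longrightarrow> (\<exists>C N. \<forall>\<phi>\<in>test_funs. fun_support \<phi> \<subseteq> K \<longrightarrow>
        norm (T \<phi>) \<le> C * (\<Sum>k\<le>N. SUP x. norm ((vderiv ^^ k) \<phi> x))))"

definition is_tempered :: "((real \<Rightarrow> complex) \<Rightarrow> complex) \<Rightarrow> bool" where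
  "is_tempered S \<longleftrightarrow> linear_on_funs schwartz_funs S \<and>
     (\<exists>C N. \<forall>\<phi>\<in>schwartz_funs.
        norm (S \<phi>) \<le> C * (\<Sum>j\<le>N. \<Sum>k\<le>N. SUP x. \<bar>x\<bar> ^ j * norm ((vderiv ^^ k) \<phi> x)))"

definition regular_distr :: "(real \<Rightarrow> real) \<Rightarrow> (real \<Rightarrow> complex) \<Rightarrow> complex" where
  "regular_distr f = (\<lambda>\<phi>. \<integral>x. complex_of_real (f x) * \<phi> x \<partial>lborel)"

definition distr_deriv :: "((real \<Rightarrow> complex) \<Rightarrow> complex) \<Rightarrow> (real \<Rightarrow> complex) \<Rightarrow> complex" where
  "distr_deriv T = (\<lambda>\<phi>. - T (vderiv \<phi>))"

definition distr_support :: "((real \<Rightarrow> complex) \<Rightarrow> complex) \<Rightarrow> real set" where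
  "distr_support T =
     - \<Union>{U. open U \<and> (\<forall>\<phi>\<in>test_funs. fun_support \<phi> \<subseteq> U \<longrightarrow> T \<phi> = 0)}"

definition causal :: "((real \<Rightarrow> complex) \<Rightarrow> complex) \<Rightarrow> bool" where
  "causal T \<longleftrightarrow> distr_support T \<subseteq> {0..}"

text \<open>Smooth functions that are 1 on a neighbourhood of \<open>[0,\<infinity>)\<close> and vanish near \<open>-\<infinity>\<close>.\<close>

definition causal_cutoff :: "(real \<Rightarrow> complex) \<Rightarrow> bool" where
  "causal_cutoff \<eta> \<longleftrightarrow>
     smooth_fun \<eta> \<and> (\<exists>a<0. \<forall>t>a. \<eta> t = 1) \<and> (\<exists>b. \<forall>t<b. \<eta> t = 0)"

text \<open>The Laplace transform at \<open>p\<close> of a causal distribution \<open>T\<close> such that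
  \<open>exp (-\<sigma>t) T\<close> is tempered for some \<open>\<sigma> < Re p\<close>: the value at \<open>\<eta> exp (-(p-\<sigma>)t)\<close> of the extension
  \<open>S\<close> of \<open>exp (-\<sigma>t) T\<close> to Schwartz functions. \<open>S\<close> is determined on Schwartz functions by
  density of the test functions, and the value depends neither on \<open>\<sigma>\<close> nor on the cut-off.\<close>

definition has_laplace_transform_at ::
    "((real \<Rightarrow> complex) \<Rightarrow> complex) \<Rightarrow> complex \<Rightarrow> complex \<Rightarrow> bool" where
  "has_laplace_transform_at T v p \<longleftrightarrow>
     is_distribution T \<and> causal T \<and>
     (\<exists>\<sigma> S. \<sigma> < Re p \<and> is_tempered S \<and>
        (\<forall>\<phi>\<in>test_funs. S \<phi> = T (\<lambda>t. exp (- of_real (\<sigma> * t)) * \<phi> t)) \<and>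
        (\<forall>\<eta>. causal_cutoff \<eta> \<longrightarrow>
           v = S (\<lambda>t. \<eta> t * exp (- (p - of_real \<sigma>) * of_real t))))"

end

(* Every statement about g and f rests on dominating the integrand by a multiple of 1 / (1 + r).
   For the Laplace transform put w(x) = f(x) exp (- \<sigma> x) with 0 < \<sigma> < Re p. Pairing
   exp (- \<sigma> x) D^2 f with \<phi> moves both derivatives onto exp (- \<sigma> x) \<phi>, which gives the integral
   of w (\<phi>'' - 2 \<sigma> \<phi>' + \<sigma>^2 \<phi>). Since w is integrable, this formula is itself the tempered
   extension. On \<eta> exp (- (p - \<sigma>) x) the second-order operator acts as multiplication by p^2 on
   [0, \<infinity>), so the transform is p^2 times the Laplace integral of f. By Fubini that integral is the
   \<nu>-integral of (1/r) (1/p - 1/(p + r)) = 1 / (p (p + r)). *)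

theory Submission
  imports Defs
begin

section \<open>Test functions and distributions\<close>

text \<open>The measure \<nu> may have infinite total mass. If the mass m is finite, D^2 f contains
  the point mass m at 0; if it is infinite, g is unbounded at 0 and its derivative is not integrable
  there. Pairing through f treats both cases at once, because f is continuous with f(0) = 0. The
  weight 1 / (1 + r) is the right yardstick: for fixed t > 0 the kernel (1 - exp (-t r)) / r stays
  near t for small r and decays like 1 / r for large r. The resulting bound on f is linear in t, so
  every positive \<sigma> makes w integrable. The cut-off cannot influence the transform, since f
  vanishes wherever \<eta> may differ from 1.\<close>

lemma smooth_fun_vderiv:
  assumes "smooth_fun \<phi>"
  shows "smooth_fun (vderiv \<phi>)"
  unfolding smooth_fun_def
proof (intro allI)
  fix n x
  have "(vderiv ^^ Suc n) \<phi> differentiable at x"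
    using assms unfolding smooth_fun_def by blast
  thus "(vderiv ^^ n) (vderiv \<phi>) differentiable at x"
    unfolding funpow_Suc_right comp_apply .
qed

lemma smooth_fun_has_vector_derivative:
  assumes "smooth_fun \<phi>"
  shows "(\<phi> has_vector_derivative vderiv \<phi> x) (at x)"
proof -
  have "(vderiv ^^ 0) \<phi> differentiable at x"
    using assms unfolding smooth_fun_def by blast
  thus ?thesis
    unfolding vderiv_def by (simp add: vector_derivative_works)
qed

lemma vderiv_eqI: "(\<phi> has_vector_derivative D) (at x) \<Longrightarrow> vderiv \<phi> x = D"
  by (simp add: vderiv_def vector_derivative_at)

text \<open>Derivatives depend only on values near the point. This form serves both the vanishing
  off a support and functions known to be exponentials only to the right of some point.\<close>

lemma vderiv_transform_open:
  assumes "open U" "x \<in> U" "\<And>y. y \<in> U \<Longrightarrow> \<phi> y = \<psi> y"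
    and "(\<psi> has_vector_derivative D) (at x)"
  shows "vderiv \<phi> x = D"
proof (rule vderiv_eqI)
  show "(\<phi> has_vector_derivative D) (at x)"
    by (rule has_vector_derivative_transform_within_open[OF assms(4,1,2)]) (simp add: assms(3))
qed

lemma smooth_fun_continuous_on:
  assumes "smooth_fun \<phi>"
  shows "continuous_on A \<phi>"
  using has_vector_derivative_continuous[OF smooth_fun_has_vector_derivative[OF assms]]
  by (simp add: continuous_at_imp_continuous_on)

lemma smooth_fun_borel_measurable [measurable_dest]:
  "smooth_fun \<phi> \<Longrightarrow> \<phi> \<in> borel_measurable borel"
  by (intro borel_measurable_continuous_onI smooth_fun_continuous_on)

lemma vderiv_linear:
  assumes "smooth_fun \<phi>" "smooth_fun \<psi>"
  shows "vderiv (\<lambda>x. c * \<phi> x + d * \<psi> x) = (\<lambda>x. c * vderiv \<phi> x + d * vderiv \<psi> x)"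
proof (rule ext, rule vderiv_eqI)
  fix x
  note assms[THEN smooth_fun_has_vector_derivative, of x, THEN has_vector_derivative_mult_right]
  from has_vector_derivative_add[OF this(1)[of c] this(2)[of d]]
  show "((\<lambda>x. c * \<phi> x + d * \<psi> x) has_vector_derivative
      c * vderiv \<phi> x + d * vderiv \<psi> x) (at x)" .
qed

lemma eq_0_if_notin_fun_support: "x \<notin> fun_support \<phi> \<Longrightarrow> \<phi> x = 0"
  using closure_subset[of "{x. \<phi> x \<noteq> 0}"] by (auto simp: fun_support_def)

text \<open>The complement of the support is open and \<phi> is zero on it, so the derivative
  vanishes there too; the support, being closed, absorbs the closure.\<close>

lemma fun_support_vderiv: "fun_support (vderiv \<phi>) \<subseteq> fun_support \<phi>"
proof -
  have "vderiv \<phi> x = 0" if "x \<notin> fun_support \<phi>" for x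
  proof (rule vderiv_transform_open[of "- fun_support \<phi>" x \<phi> "\<lambda>_. 0"])
    show "open (- fun_support \<phi>)"
      by (simp add: fun_support_def open_Compl)
  qed (use that in \<open>simp_all add: eq_0_if_notin_fun_support\<close>)
  hence "{x. vderiv \<phi> x \<noteq> 0} \<subseteq> fun_support \<phi>"
    by blast
  hence "closure {x. vderiv \<phi> x \<noteq> 0} \<subseteq> fun_support \<phi>"
    by (rule closure_minimal) (simp add: fun_support_def)
  thus ?thesis
    by (simp add: fun_support_def)
qed

lemma test_funs_vderiv:
  assumes "\<phi> \<in> test_funs"
  shows "vderiv \<phi> \<in> test_funs"
proof -
  have "closed (fun_support (vderiv \<phi>))" "compact (fun_support \<phi>)"
    using assms by (simp_all add: fun_support_def test_funs_def)
  hence "compact (fun_support \<phi> \<inter> fun_support (vderiv \<phi>))"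
    by blast
  thus ?thesis
    using assms fun_support_vderiv[of \<phi>] smooth_fun_vderiv[of \<phi>]
    by (simp add: test_funs_def inf.absorb2)
qed

lemma test_funs_funpow_vderiv: "\<phi> \<in> test_funs \<Longrightarrow> (vderiv ^^ k) \<phi> \<in> test_funs"
  by (induction k) (simp_all add: test_funs_vderiv)

text \<open>A real \<open>SUP\<close> says something only about a set that is bounded above. The
  bound \<open>max B 0\<close> also covers an empty support, where \<open>B\<close> could be
  negative.\<close>

lemma test_funs_bdd_above:
  assumes "\<phi> \<in> test_funs"
  shows "bdd_above (range (\<lambda>x. norm (\<phi> x)))"
proof -
  have "compact (\<phi> ` fun_support \<phi>)"
    using assms by (auto simp: test_funs_def intro!: compact_continuous_image smooth_fun_continuous_on)
  hence "bounded (\<phi> ` fun_support \<phi>)"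
    by (rule compact_imp_bounded)
  then obtain B where B: "\<And>x. x \<in> fun_support \<phi> \<Longrightarrow> norm (\<phi> x) \<le> B"
    by (auto simp: bounded_iff)
  have "norm (\<phi> x) \<le> max B 0" for x
    using B[of x] eq_0_if_notin_fun_support[of x \<phi>] by (cases "x \<in> fun_support \<phi>") auto
  thus ?thesis
    by (rule bdd_aboveI2)
qed

lemma test_funs_SUP_nonneg:
  assumes "\<phi> \<in> test_funs"
  shows "0 \<le> (SUP x. norm (\<phi> x))"
  by (rule cSUP_upper2[OF test_funs_bdd_above[OF assms], of 0]) auto

section \<open>Distributional differentiation\<close>

lemma is_distribution_distr_deriv:
  assumes "is_distribution T"
  shows "is_distribution (distr_deriv T)"
  unfolding is_distribution_def
proof (intro conjI allI impI)
  show "linear_on_funs test_funs (distr_deriv T)"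
    unfolding linear_on_funs_def
  proof (intro ballI allI)
    fix \<phi> \<psi> c d assume *: "\<phi> \<in> test_funs" "\<psi> \<in> test_funs"
    have "T (\<lambda>x. c * vderiv \<phi> x + d * vderiv \<psi> x) = c * T (vderiv \<phi>) + d * T (vderiv \<psi>)"
      using assms * by (simp add: is_distribution_def linear_on_funs_def test_funs_vderiv)
    thus "distr_deriv T (\<lambda>x. c * \<phi> x + d * \<psi> x) = c * distr_deriv T \<phi> + d * distr_deriv T \<psi>"
      using * by (simp add: distr_deriv_def test_funs_def vderiv_linear)
  qed
next
  fix K :: "real set" assume "compact K"
  then obtain C N where CN: "\<And>\<phi>. \<phi> \<in> test_funs \<Longrightarrow> fun_support \<phi> \<subseteq> K \<Longrightarrow>
      norm (T \<phi>) \<le> C * (\<Sum>k\<le>N. SUP x. norm ((vderiv ^^ k) \<phi> x))"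
    using assms unfolding is_distribution_def by meson
  \<comment> \<open>Differentiating shifts the seminorm index by one, so the order becomes
    \<open>Suc N\<close>. The sign of \<open>C\<close> is unknown; with its absolute value the
    additional term k = 0 can only enlarge the bound.\<close>
  have "norm (distr_deriv T \<phi>) \<le> \<bar>C\<bar> * (\<Sum>k\<le>Suc N. SUP x. norm ((vderiv ^^ k) \<phi> x))"
    if \<phi>: "\<phi> \<in> test_funs" "fun_support \<phi> \<subseteq> K" for \<phi>
  proof -
    define s where "s k = (SUP x. norm ((vderiv ^^ k) \<phi> x))" for k
    have s: "0 \<le> s k" for k
      unfolding s_def by (intro test_funs_SUP_nonneg test_funs_funpow_vderiv \<phi>)
    have "norm (distr_deriv T \<phi>) \<le> C * (\<Sum>k\<le>N. SUP x. norm ((vderiv ^^ k) (vderiv \<phi>) x))"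
      unfolding distr_deriv_def norm_minus_cancel
      using \<phi> fun_support_vderiv[of \<phi>] by (intro CN test_funs_vderiv) auto
    also have "(\<lambda>k. SUP x. norm ((vderiv ^^ k) (vderiv \<phi>) x)) = (\<lambda>k. s (Suc k))"
      unfolding s_def funpow_Suc_right comp_apply ..
    also have "C * (\<Sum>k\<le>N. s (Suc k)) \<le> \<bar>C\<bar> * (\<Sum>k\<le>N. s (Suc k))"
      using s by (intro mult_right_mono sum_nonneg) auto
    also have "\<dots> \<le> \<bar>C\<bar> * (\<Sum>k\<le>Suc N. s k)"
      using s by (intro mult_left_mono) (auto simp: sum.atMost_Suc_shift simp del: sum.atMost_Suc)
    finally show ?thesis
      unfolding s_def .
  qed
  thus "\<exists>C N. \<forall>\<phi>\<in>test_funs. fun_support \<phi> \<subseteq> K \<longrightarrow>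
      norm (distr_deriv T \<phi>) \<le> C * (\<Sum>k\<le>N. SUP x. norm ((vderiv ^^ k) \<phi> x))"
    by blast
qed

text \<open>Differentiation does not enlarge the support of a test function, so the derivative of
  \<open>T\<close> vanishes on every open set on which \<open>T\<close> does; the union of such sets
  can only grow.\<close>

lemma distr_support_distr_deriv: "distr_support (distr_deriv T) \<subseteq> distr_support T"
proof -
  have "distr_deriv T \<phi> = 0"
    if "\<forall>\<phi>\<in>test_funs. fun_support \<phi> \<subseteq> U \<longrightarrow> T \<phi> = 0" "\<phi> \<in> test_funs" "fun_support \<phi> \<subseteq> U"
    for U \<phi>
    using that test_funs_vderiv[of \<phi>] fun_support_vderiv[of \<phi>]
    by (simp add: distr_deriv_def)
  thus ?thesis
    unfolding distr_support_def by (intro Compl_anti_mono Union_mono Collect_mono) blast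
qed

lemma causal_distr_deriv: "causal T \<Longrightarrow> causal (distr_deriv T)"
  unfolding causal_def using distr_support_distr_deriv[of T] by simp

section \<open>Distributions given by functions\<close>

lemma integrable_mult_test_fun:
  fixes f :: "real \<Rightarrow> real"
  assumes "continuous_on UNIV f" "\<phi> \<in> test_funs"
  shows "integrable lborel (\<lambda>x. complex_of_real (f x) * \<phi> x)"
proof -
  have "integrable lborel (\<lambda>x. indicator (fun_support \<phi>) x *\<^sub>R (complex_of_real (f x) * \<phi> x))"
    using assms
    by (intro borel_integrable_compact continuous_intros smooth_fun_continuous_on)
       (auto simp: test_funs_def intro: continuous_on_subset)
  also have "(\<lambda>x. indicator (fun_support \<phi>) x *\<^sub>R (complex_of_real (f x) * \<phi> x)) =
      (\<lambda>x. complex_of_real (f x) * \<phi> x)"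
    using eq_0_if_notin_fun_support[of _ \<phi>] by (auto simp: indicator_def)
  finally show ?thesis .
qed

lemma is_distribution_regular_distr:
  assumes f: "continuous_on UNIV f"
  shows "is_distribution (regular_distr f)"
  unfolding is_distribution_def
proof (intro conjI allI impI)
  show "linear_on_funs test_funs (regular_distr f)"
    unfolding linear_on_funs_def
  proof (intro ballI allI)
    fix \<phi> \<psi> c d assume *: "\<phi> \<in> test_funs" "\<psi> \<in> test_funs"
    have "regular_distr f (\<lambda>x. c * \<phi> x + d * \<psi> x) =
        (\<integral>x. c * (complex_of_real (f x) * \<phi> x) + d * (complex_of_real (f x) * \<psi> x) \<partial>lborel)"
      by (simp add: regular_distr_def algebra_simps)
    also have "\<dots> = c * regular_distr f \<phi> + d * regular_distr f \<psi>"
      by (simp add: regular_distr_def integrable_mult_test_fun[OF f] *)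
    finally show "regular_distr f (\<lambda>x. c * \<phi> x + d * \<psi> x) =
        c * regular_distr f \<phi> + d * regular_distr f \<psi>" .
  qed
next
  fix K :: "real set" assume K: "compact K"
  \<comment> \<open>The order is 0: for \<phi> supported in \<open>K\<close>, the integral of |f|
    over \<open>K\<close> times the supremum of |\<phi>| bounds the pairing.\<close>
  define C where "C = (\<integral>x. indicator K x *\<^sub>R \<bar>f x\<bar> \<partial>lborel)"
  have int: "integrable lborel (\<lambda>x. indicator K x *\<^sub>R \<bar>f x\<bar>)"
    using f by (intro borel_integrable_compact K continuous_intros) (auto intro: continuous_on_subset)
  have "norm (regular_distr f \<phi>) \<le> C * (\<Sum>k\<le>0. SUP x. norm ((vderiv ^^ k) \<phi> x))"
    if \<phi>: "\<phi> \<in> test_funs" "fun_support \<phi> \<subseteq> K" for \<phi>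
  proof -
    define s where "s = (SUP x. norm (\<phi> x))"
    have "norm (regular_distr f \<phi>) \<le> (\<integral>x. (indicator K x *\<^sub>R \<bar>f x\<bar>) * s \<partial>lborel)"
      unfolding regular_distr_def
    proof (rule Bochner_Integration.integral_norm_bound_integral)
      show "integrable lborel (\<lambda>x. (indicator K x *\<^sub>R \<bar>f x\<bar>) * s)"
        using int by (rule integrable_mult_left)
      show "integrable lborel (\<lambda>x. complex_of_real (f x) * \<phi> x)"
        by (intro integrable_mult_test_fun f \<phi>)
      fix x
      have "norm (\<phi> x) \<le> s"
        unfolding s_def by (intro cSUP_upper test_funs_bdd_above \<phi>) auto
      moreover have "\<phi> x = 0" if "x \<notin> K"
        using that \<phi> eq_0_if_notin_fun_support by blast
      ultimately show "norm (complex_of_real (f x) * \<phi> x) \<le> (indicator K x *\<^sub>R \<bar>f x\<bar>) * s"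
        by (cases "x \<in> K") (auto simp: norm_mult mult_left_mono)
    qed
    thus ?thesis
      using int by (simp add: C_def s_def)
  qed
  thus "\<exists>C N. \<forall>\<phi>\<in>test_funs. fun_support \<phi> \<subseteq> K \<longrightarrow>
      norm (regular_distr f \<phi>) \<le> C * (\<Sum>k\<le>N. SUP x. norm ((vderiv ^^ k) \<phi> x))"
    by blast
qed

lemma causal_regular_distr:
  assumes "\<And>x. x < 0 \<Longrightarrow> f x = 0"
  shows "causal (regular_distr f)"
proof -
  have "regular_distr f \<phi> = 0" if "fun_support \<phi> \<subseteq> {..<0}" for \<phi>
  proof -
    have "(\<lambda>x. complex_of_real (f x) * \<phi> x) = (\<lambda>_. 0)"
    proof
      show "complex_of_real (f x) * \<phi> x = 0" for x
        using that assms[of x] eq_0_if_notin_fun_support[of x \<phi>] by (cases "x < 0") auto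
    qed
    thus ?thesis
      by (simp add: regular_distr_def)
  qed
  \<comment> \<open>The open negative half-line itself belongs to the family whose union is the
    complement of the support.\<close>
  hence "{..<0} \<subseteq> \<Union>{U. open U \<and> (\<forall>\<phi>\<in>test_funs. fun_support \<phi> \<subseteq> U \<longrightarrow> regular_distr f \<phi> = 0)}"
    by (intro Union_upper) simp
  moreover have "{0..} = - {..<0::real}"
    by auto
  ultimately show ?thesis
    unfolding causal_def distr_support_def by (simp only: Compl_subset_Compl_iff)
qed

section \<open>Differentiation under an exponential weight\<close>

lemma vderiv_exp_mult:
  assumes "smooth_fun \<phi>"
  shows "vderiv (\<lambda>t. exp (- of_real (\<sigma> * t)) * \<phi> t) =
      (\<lambda>t. exp (- of_real (\<sigma> * t)) * (vderiv \<phi> t - of_real \<sigma> * \<phi> t))"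
proof (rule ext, rule vderiv_eqI)
  fix t
  have *: "((\<lambda>z. exp (- (of_real \<sigma> * z))) has_field_derivative
      - of_real \<sigma> * exp (- (of_real \<sigma> * z))) (at z)" for z :: complex
    by (auto intro!: derivative_eq_intros)
  have "((\<lambda>t. exp (- complex_of_real (\<sigma> * t))) has_vector_derivative
      - of_real \<sigma> * exp (- complex_of_real (\<sigma> * t))) (at t)"
    using has_vector_derivative_real_field[OF *, of t] by simp
  from has_vector_derivative_mult[OF this smooth_fun_has_vector_derivative[OF assms]]
  show "((\<lambda>t. exp (- of_real (\<sigma> * t)) * \<phi> t) has_vector_derivative
      exp (- of_real (\<sigma> * t)) * (vderiv \<phi> t - of_real \<sigma> * \<phi> t)) (at t)"
    by (simp add: algebra_simps)
qed

lemma smooth_fun_funpow_vderiv: "smooth_fun \<phi> \<Longrightarrow> smooth_fun ((vderiv ^^ n) \<phi>)"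
  by (induction n) (simp_all add: smooth_fun_vderiv)

lemma smooth_fun_linear:
  assumes "smooth_fun \<phi>" "smooth_fun \<psi>"
  shows "smooth_fun (\<lambda>x. c * \<phi> x + d * \<psi> x)"
proof -
  have *: "(vderiv ^^ n) (\<lambda>x. c * \<phi> x + d * \<psi> x) =
      (\<lambda>x. c * (vderiv ^^ n) \<phi> x + d * (vderiv ^^ n) \<psi> x)" for n
    by (induction n) (simp_all add: vderiv_linear smooth_fun_funpow_vderiv assms)
  have "(\<lambda>x. c * (vderiv ^^ n) \<phi> x + d * (vderiv ^^ n) \<psi> x) differentiable at x" for n x
    using assms unfolding smooth_fun_def by (intro differentiable_add differentiable_mult) auto
  thus ?thesis
    unfolding smooth_fun_def * by blast
qed

text \<open>Conjugation by exp (-\<sigma> t) turns differentiation D into D - \<sigma>, so two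
  derivatives give (D - \<sigma>)^2, expanded here.\<close>

lemma vderiv_vderiv_exp_mult:
  assumes "smooth_fun \<phi>"
  shows "vderiv (vderiv (\<lambda>t. exp (- of_real (\<sigma> * t)) * \<phi> t)) =
      (\<lambda>t. exp (- of_real (\<sigma> * t)) *
         (vderiv (vderiv \<phi>) t - 2 * of_real \<sigma> * vderiv \<phi> t + (of_real \<sigma>)\<^sup>2 * \<phi> t))"
proof -
  \<comment> \<open>Explicit coefficients 1 and -\<sigma> let the lemmas on linear combinations
    match syntactically.\<close>
  define \<psi> where "\<psi> = (\<lambda>t. 1 * vderiv \<phi> t + (- of_real \<sigma>) * \<phi> t)"
  have \<psi>: "smooth_fun \<psi>"
    unfolding \<psi>_def by (intro smooth_fun_linear smooth_fun_vderiv assms)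
  have "vderiv \<psi> = (\<lambda>t. 1 * vderiv (vderiv \<phi>) t + (- of_real \<sigma>) * vderiv \<phi> t)"
    unfolding \<psi>_def by (intro vderiv_linear smooth_fun_vderiv assms)
  moreover have "vderiv (\<lambda>t. exp (- of_real (\<sigma> * t)) * \<phi> t) =
      (\<lambda>t. exp (- of_real (\<sigma> * t)) * \<psi> t)"
    unfolding vderiv_exp_mult[OF assms] \<psi>_def by simp
  ultimately show ?thesis
    by (simp only: vderiv_exp_mult[OF \<psi>])
       (simp add: \<psi>_def algebra_simps power2_eq_square)
qed

section \<open>Tempered extension and Laplace transform of a second derivative\<close>

lemma schwartz_funs_smooth: "\<phi> \<in> schwartz_funs \<Longrightarrow> smooth_fun \<phi>"
  by (simp add: schwartz_funs_def)

lemma schwartz_funs_bdd_above: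
  assumes "\<phi> \<in> schwartz_funs"
  shows "bdd_above (range (\<lambda>x. \<bar>x\<bar> ^ j * norm ((vderiv ^^ k) \<phi> x)))"
  using assms by (auto simp: schwartz_funs_def intro!: bounded_imp_bdd_above)

lemma schwartz_funs_SUP_nonneg:
  assumes "\<phi> \<in> schwartz_funs"
  shows "0 \<le> (SUP x. \<bar>x\<bar> ^ j * norm ((vderiv ^^ k) \<phi> x))"
  by (rule cSUP_upper2[OF schwartz_funs_bdd_above[OF assms], of 0]) auto

lemma norm_funpow_vderiv_le_SUP:
  assumes "\<phi> \<in> schwartz_funs"
  shows "norm ((vderiv ^^ k) \<phi> x) \<le> (SUP x. \<bar>x\<bar> ^ 0 * norm ((vderiv ^^ k) \<phi> x))"
  using cSUP_upper[OF _ schwartz_funs_bdd_above[OF assms, of 0 k], of x] by simp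

text \<open>The free coefficient \<open>c\<close> makes the rule applicable to its own output, which
  yields the second derivative as well.\<close>

lemma vderiv_exp:
  assumes "open U" "x \<in> U" "\<And>t. t \<in> U \<Longrightarrow> \<phi> t = c * exp (- p * of_real t)"
  shows "vderiv \<phi> x = - p * c * exp (- p * of_real x)"
proof (rule vderiv_transform_open[OF assms])
  have *: "((\<lambda>z. c * exp (- p * z)) has_field_derivative - p * c * exp (- p * z)) (at z)" for z
    by (auto intro!: derivative_eq_intros)
  show "((\<lambda>t. c * exp (- p * of_real t)) has_vector_derivative
      - p * c * exp (- p * of_real x)) (at x)"
    using has_vector_derivative_real_field[OF *, of x] by simp
qed

text \<open>The second-order expression is bounded uniformly in x by seminorms of \<phi>, and the
  integrable weight \<open>w\<close> turns this into a bound on the integral.\<close>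

lemma is_tempered_second_order:
  fixes w :: "real \<Rightarrow> real" and c\<^sub>0 c\<^sub>1 :: complex
  assumes w: "integrable lborel w"
  shows "is_tempered (\<lambda>\<phi>. \<integral>x. of_real (w x) *
           (vderiv (vderiv \<phi>) x + c\<^sub>1 * vderiv \<phi> x + c\<^sub>0 * \<phi> x) \<partial>lborel)"
proof -
  define L where "L \<phi> x = vderiv (vderiv \<phi>) x + c\<^sub>1 * vderiv \<phi> x + c\<^sub>0 * \<phi> x" for \<phi> x
  define s where "s \<phi> j k = (SUP x. \<bar>x\<bar> ^ j * norm ((vderiv ^^ k) \<phi> x))" for \<phi> j k
  define A where "A = 1 + norm c\<^sub>1 + norm c\<^sub>0"
  \<comment> \<open>Order 2 comes from the second derivative. Temperedness uses one bound for powers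
    and derivatives; the terms with j > 0 are nonnegative and only enlarge the sum.\<close>
  define N where "N \<phi> = (\<Sum>j\<le>2. \<Sum>k\<le>2. s \<phi> j k)" for \<phi>
  have L_le: "norm (L \<phi> x) \<le> A * N \<phi>" if \<phi>: "\<phi> \<in> schwartz_funs" for \<phi> x
  proof -
    have s: "0 \<le> s \<phi> j k" for j k
      unfolding s_def by (rule schwartz_funs_SUP_nonneg[OF \<phi>])
    have le: "norm ((vderiv ^^ k) \<phi> x) \<le> s \<phi> 0 k" for k
      unfolding s_def by (rule norm_funpow_vderiv_le_SUP[OF \<phi>])
    have "s \<phi> 0 k \<le> N \<phi>" if "k \<le> 2" for k
    proof -
      have "s \<phi> 0 k \<le> (\<Sum>k\<le>2. s \<phi> 0 k)"
        using that s by (intro member_le_sum) auto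
      also have "\<dots> \<le> N \<phi>"
        unfolding N_def using s by (intro member_le_sum[of 0 _ "\<lambda>j. \<Sum>k\<le>2. s \<phi> j k"] sum_nonneg) auto
      finally show ?thesis .
    qed
    hence le_N: "norm ((vderiv ^^ k) \<phi> x) \<le> N \<phi>" if "k \<le> 2" for k
      using le[of k] that order_trans by blast
    have "norm (L \<phi> x) \<le> norm (vderiv (vderiv \<phi>) x) + norm (c\<^sub>1 * vderiv \<phi> x) + norm (c\<^sub>0 * \<phi> x)"
      unfolding L_def by (intro order_trans[OF norm_triangle_ineq] add_mono order_refl)
    also have "\<dots> \<le> N \<phi> + norm c\<^sub>1 * N \<phi> + norm c\<^sub>0 * N \<phi>"
      using le_N[of 0] le_N[of 1] le_N[of 2]
      unfolding norm_mult by (intro add_mono mult_left_mono) (simp_all add: numeral_2_eq_2)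
    finally show ?thesis
      by (simp add: A_def algebra_simps)
  qed
  have int: "integrable lborel (\<lambda>x. of_real (w x) * L \<phi> x)" if \<phi>: "\<phi> \<in> schwartz_funs" for \<phi>
  proof (rule Bochner_Integration.integrable_bound)
    show "integrable lborel (\<lambda>x. w x * (A * N \<phi>))"
      using w by (rule integrable_mult_left)
    have [measurable]: "\<phi> \<in> borel_measurable borel" "vderiv \<phi> \<in> borel_measurable borel"
        "vderiv (vderiv \<phi>) \<in> borel_measurable borel"
      by (intro smooth_fun_borel_measurable smooth_fun_vderiv schwartz_funs_smooth \<phi>)+
    have [measurable]: "w \<in> borel_measurable borel"
      using borel_measurable_integrable[OF w] by simp
    show "(\<lambda>x. of_real (w x) * L \<phi> x) \<in> borel_measurable lborel"
      unfolding L_def by measurable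
    show "AE x in lborel. norm (of_real (w x) * L \<phi> x) \<le> norm (w x * (A * N \<phi>))"
    proof (rule AE_I2)
      fix x
      show "norm (of_real (w x) * L \<phi> x) \<le> norm (w x * (A * N \<phi>))"
        using order_trans[OF L_le[OF \<phi>, of x] abs_ge_self]
        by (simp add: norm_mult abs_mult mult_left_mono)
    qed
  qed
  have "linear_on_funs schwartz_funs (\<lambda>\<phi>. \<integral>x. of_real (w x) * L \<phi> x \<partial>lborel)"
    unfolding linear_on_funs_def
  proof (intro ballI allI)
    fix \<phi> \<psi> c d assume *: "\<phi> \<in> schwartz_funs" "\<psi> \<in> schwartz_funs"
    note smooth = *[THEN schwartz_funs_smooth]
    have "of_real (w x) * L (\<lambda>x. c * \<phi> x + d * \<psi> x) x =
        c * (of_real (w x) * L \<phi> x) + d * (of_real (w x) * L \<psi> x)" for x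
      by (simp add: L_def vderiv_linear smooth smooth_fun_vderiv algebra_simps)
    thus "(\<integral>x. of_real (w x) * L (\<lambda>x. c * \<phi> x + d * \<psi> x) x \<partial>lborel) =
        c * (\<integral>x. of_real (w x) * L \<phi> x \<partial>lborel) + d * (\<integral>x. of_real (w x) * L \<psi> x \<partial>lborel)"
      by (simp add: int *)
  qed
  moreover have "norm (\<integral>x. of_real (w x) * L \<phi> x \<partial>lborel) \<le> ((\<integral>x. \<bar>w x\<bar> \<partial>lborel) * A) * N \<phi>"
    if \<phi>: "\<phi> \<in> schwartz_funs" for \<phi>
  proof -
    have "norm (\<integral>x. of_real (w x) * L \<phi> x \<partial>lborel) \<le> (\<integral>x. \<bar>w x\<bar> * (A * N \<phi>) \<partial>lborel)"
      using L_le[OF \<phi>]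
      by (intro Bochner_Integration.integral_norm_bound_integral int \<phi> integrable_mult_left
          integrable_abs w) (simp add: norm_mult mult_left_mono)
    thus ?thesis
      by (simp add: mult.assoc)
  qed
  ultimately show ?thesis
    unfolding is_tempered_def L_def N_def s_def by blast
qed

lemma has_laplace_transform_at_second_derivative:
  fixes f :: "real \<Rightarrow> real"
  assumes f: "continuous_on UNIV f" "\<And>x. x \<le> 0 \<Longrightarrow> f x = 0"
    and \<sigma>: "\<sigma> < Re p" "integrable lborel (\<lambda>x. f x * exp (- \<sigma> * x))"
  shows "has_laplace_transform_at (distr_deriv (distr_deriv (regular_distr f)))
      (p\<^sup>2 * (\<integral>x. of_real (f x) * exp (- p * of_real x) \<partial>lborel)) p"
proof -
  define T where "T = distr_deriv (distr_deriv (regular_distr f))"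
  have T_eq: "T \<phi> = (\<integral>x. of_real (f x) * vderiv (vderiv \<phi>) x \<partial>lborel)" for \<phi>
    by (simp add: T_def distr_deriv_def regular_distr_def)
  \<comment> \<open>The coefficients are those of (D - \<sigma>)^2, so that \<open>S\<close> agrees
    with the weighted \<open>T\<close> on test functions.\<close>
  define S where "S \<phi> = (\<integral>x. of_real (f x * exp (- \<sigma> * x)) * (vderiv (vderiv \<phi>) x +
      (- 2 * of_real \<sigma>) * vderiv \<phi> x + (of_real \<sigma>)\<^sup>2 * \<phi> x) \<partial>lborel)" for \<phi>
  have "is_tempered S"
    unfolding S_def by (rule is_tempered_second_order[OF \<sigma>(2)])
  moreover have "S \<phi> = T (\<lambda>t. exp (- of_real (\<sigma> * t)) * \<phi> t)" if "\<phi> \<in> test_funs" for \<phi>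
  proof -
    have "smooth_fun \<phi>"
      using that by (simp add: test_funs_def)
    show ?thesis
      unfolding S_def T_eq vderiv_vderiv_exp_mult[OF \<open>smooth_fun \<phi>\<close>]
      by (intro Bochner_Integration.integral_cong refl)
         (simp add: exp_of_real[symmetric] algebra_simps)
  qed
  moreover have "p\<^sup>2 * (\<integral>x. of_real (f x) * exp (- p * of_real x) \<partial>lborel) =
      S (\<lambda>t. \<eta> t * exp (- (p - of_real \<sigma>) * of_real t))" if \<eta>: "causal_cutoff \<eta>" for \<eta>
  proof -
    obtain a where a: "a < 0" "\<And>t. t > a \<Longrightarrow> \<eta> t = 1"
      using \<eta> by (auto simp: causal_cutoff_def)
    define q where "q = p - of_real \<sigma>"
    define \<psi> where "\<psi> = (\<lambda>t. \<eta> t * exp (- q * of_real t))"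
    \<comment> \<open>The factor 1 puts \<psi> into the shape that \<open>vderiv_exp\<close>
      expects.\<close>
    have \<psi>: "\<psi> x = 1 * exp (- q * of_real x)" if "x \<in> {a<..}" for x
      using a that by (simp add: \<psi>_def)
    have \<psi>': "vderiv \<psi> x = - q * exp (- q * of_real x)" if "x \<in> {a<..}" for x
      using vderiv_exp[OF open_greaterThan that \<psi>] by simp
    have \<psi>'': "vderiv (vderiv \<psi>) x = q\<^sup>2 * exp (- q * of_real x)" if "x \<in> {a<..}" for x
      using vderiv_exp[OF open_greaterThan that \<psi>'] by (simp add: power2_eq_square)
    \<comment> \<open>The integrands agree pointwise. For x \<le> 0 both vanish because f does; for
      x > 0 the point lies beyond \<open>a\<close>, where \<psi> is a pure exponential and (D -
      \<sigma>)^2 multiplies it by (q + \<sigma>)^2 = p^2.\<close>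
    have eq: "p\<^sup>2 * (of_real (f x) * exp (- p * of_real x)) =
        of_real (f x * exp (- \<sigma> * x)) *
        (vderiv (vderiv \<psi>) x + (- 2 * of_real \<sigma>) * vderiv \<psi> x + (of_real \<sigma>)\<^sup>2 * \<psi> x)" for x
    proof (cases "x \<le> 0")
      case False
      hence x: "x \<in> {a<..}"
        using a by simp
      have "exp (- p * of_real x) = exp (of_real (- \<sigma> * x)) * exp (- q * of_real x)"
        by (simp add: q_def algebra_simps flip: exp_add)
      hence "exp (- p * of_real x) = of_real (exp (- \<sigma> * x)) * exp (- q * of_real x)"
        by (simp only: exp_of_real)
      moreover have "p = q + of_real \<sigma>"
        by (simp add: q_def)
      ultimately show ?thesis
        by (simp add: \<psi>[OF x] \<psi>'[OF x] \<psi>''[OF x] algebra_simps power2_eq_square)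
    qed (simp add: f)
    have "p\<^sup>2 * (\<integral>x. of_real (f x) * exp (- p * of_real x) \<partial>lborel) =
        (\<integral>x. p\<^sup>2 * (of_real (f x) * exp (- p * of_real x)) \<partial>lborel)"
      by (rule integral_mult_right_zero[symmetric])
    also have "\<dots> = S \<psi>"
      unfolding S_def eq ..
    finally show ?thesis
      unfolding q_def[symmetric] \<psi>_def[symmetric] .
  qed
  moreover have "is_distribution T" "causal T"
    unfolding T_def
    by (intro is_distribution_distr_deriv is_distribution_regular_distr f causal_distr_deriv
        causal_regular_distr; simp)+
  ultimately show ?thesis
    using \<sigma>(1) unfolding has_laplace_transform_at_def T_def by blast
qed

section \<open>Exponential integrals and differentiation under the integral\<close>

lemma set_lborel_exp_Ioi:
  fixes x :: real
  assumes "0 < x"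
  shows "set_integrable lborel {0<..} (\<lambda>t. exp (- x * t))"
    and "(\<integral>t\<in>{0<..}. exp (- x * t) \<partial>lborel) = 1 / x"
proof -
  define F where "F t = - exp (- x * t) / x" for t
  have F: "(F has_real_derivative exp (- x * t)) (at t)" for t
    using assms unfolding F_def by (auto intro!: derivative_eq_intros)
  have "isCont F 0"
    using F DERIV_isCont by blast
  hence at_0: "((F \<circ> real_of_ereal) \<longlongrightarrow> - 1 / x) (at_right (ereal 0))"
    by (simp add: ereal_tendsto_simps continuous_within F_def filterlim_at_split)
  have "(F \<longlongrightarrow> 0) at_top"
    unfolding F_def using assms by real_asymp
  hence at_inf: "((F \<circ> real_of_ereal) \<longlongrightarrow> 0) (at_left \<infinity>)"
    by (simp add: ereal_tendsto_simps)
  have "isCont (\<lambda>t. exp (- x * t)) t" for t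
    by simp
  note FTC = interval_integral_FTC_nonneg[where a = "ereal 0" and b = \<infinity>,
      OF _ F this _ at_0 at_inf]
  show "set_integrable lborel {0<..} (\<lambda>t. exp (- x * t))"
    using FTC(1) by simp
  show "(\<integral>t\<in>{0<..}. exp (- x * t) \<partial>lborel) = 1 / x"
    using FTC(2) by (simp add: interval_integral_to_infinity_eq)
qed

text \<open>Integrability comes from the real case with rate Re z, since |exp (-z t)| = exp (-Re z
  t); the value then follows from the antiderivative \<open>F\<close>.\<close>

lemma set_lborel_complex_exp_Ioi:
  fixes z :: complex
  assumes "0 < Re z"
  shows "set_integrable lborel {0<..} (\<lambda>t. exp (- z * of_real t))"
    and "(\<integral>t\<in>{0<..}. exp (- z * of_real t) \<partial>lborel) = 1 / z"
proof -
  define F where "F t = - exp (- z * of_real t) / z" for t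
  have "z \<noteq> 0"
    using assms by auto
  have *: "((\<lambda>w. - exp (- z * w) / z) has_field_derivative exp (- z * w)) (at w)" for w
    using \<open>z \<noteq> 0\<close> by (auto intro!: derivative_eq_intros)
  have F: "(F has_vector_derivative exp (- z * of_real t)) (at t)" for t
    using has_vector_derivative_real_field[OF *, of t] unfolding F_def by simp
  show int: "set_integrable lborel {0<..} (\<lambda>t. exp (- z * of_real t))"
    unfolding set_integrable_def
  proof (rule Bochner_Integration.integrable_bound)
    show "integrable lborel (\<lambda>t. indicator {0<..} t *\<^sub>R exp (- Re z * t))"
      using set_lborel_exp_Ioi(1)[OF assms] by (simp add: set_integrable_def)
    show "(\<lambda>t. indicator {0<..} t *\<^sub>R exp (- z * of_real t)) \<in> borel_measurable lborel"
      by measurable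
  qed simp
  have "isCont F 0"
    using F has_vector_derivative_continuous by blast
  hence at_0: "((F \<circ> real_of_ereal) \<longlongrightarrow> - 1 / z) (at_right (ereal 0))"
    by (simp add: ereal_tendsto_simps continuous_within F_def filterlim_at_split)
  \<comment> \<open>Decay of \<open>F\<close> is checked on norms, where the oscillating factor
    disappears.\<close>
  have "((\<lambda>t. exp (- Re z * t) / norm z) \<longlongrightarrow> 0) at_top"
    using assms \<open>z \<noteq> 0\<close> by real_asymp
  hence "((\<lambda>t. norm (F t)) \<longlongrightarrow> 0) at_top"
    by (simp add: F_def norm_divide)
  hence "(F \<longlongrightarrow> 0) at_top"
    by (rule tendsto_norm_zero_cancel)
  hence at_inf: "((F \<circ> real_of_ereal) \<longlongrightarrow> 0) (at_left \<infinity>)"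
    by (simp add: ereal_tendsto_simps)
  have "isCont (\<lambda>t. exp (- z * complex_of_real t)) t" for t
    by simp
  from interval_integral_FTC_integrable[where a = "ereal 0" and b = \<infinity>,
      OF _ F this _ at_0 at_inf] int
  show "(\<integral>t\<in>{0<..}. exp (- z * of_real t) \<partial>lborel) = 1 / z"
    by (simp add: interval_integral_to_infinity_eq)
qed

lemma set_lborel_exp_Ioc:
  fixes r T :: real
  assumes "0 < r" "0 \<le> T"
  shows "set_integrable lborel {0<..T} (\<lambda>t. exp (- r * t))"
    and "(\<integral>t\<in>{0<..T}. exp (- r * t) \<partial>lborel) = (1 - exp (- T * r)) / r"
proof -
  have *: "((\<lambda>t. - exp (- r * t) / r) has_real_derivative exp (- r * t)) (at t)" for t
    using assms by (auto intro!: derivative_eq_intros)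
  have "has_bochner_integral lborel (\<lambda>t. exp (- r * t) * indicator {0..T} t)
      (- exp (- r * T) / r - - exp (- r * 0) / r)"
    using assms(2) by (intro has_bochner_integral_FTC_Icc_real *) auto
  \<comment> \<open>The closed and the half-open interval differ by the null set {0}; the half-open
    one matches \<open>f_fun\<close>.\<close>
  also have "?this \<longleftrightarrow> has_bochner_integral lborel (\<lambda>t. indicator {0<..T} t *\<^sub>R exp (- r * t))
      (- exp (- r * T) / r - - exp (- r * 0) / r)"
  proof (rule has_bochner_integral_cong_AE)
    show "AE t in lborel. exp (- r * t) * indicator {0..T} t =
        indicator {0<..T} t *\<^sub>R exp (- r * t)"
      using AE_lborel_singleton[of 0] by eventually_elim (auto simp: indicator_def)
  qed measurable
  finally show "set_integrable lborel {0<..T} (\<lambda>t. exp (- r * t))"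
    and "(\<integral>t\<in>{0<..T}. exp (- r * t) \<partial>lborel) = (1 - exp (- T * r)) / r"
    unfolding set_integrable_def set_lebesgue_integral_def
    by (auto simp: has_bochner_integral_iff diff_divide_distrib mult.commute)
qed

text \<open>A Taylor remainder of size h^2 with an integrable coefficient \<open>K\<close>
  integrates to h^2 times a constant, so the difference quotient misses the candidate derivative by
  at most |h| times that constant.\<close>

lemma has_real_derivative_integral:
  fixes u :: "real \<Rightarrow> 'a \<Rightarrow> real"
  assumes "0 < \<delta>"
    and u: "\<And>s. \<bar>s - t\<bar> < \<delta> \<Longrightarrow> integrable M (u s)"
    and v: "integrable M v" and K: "integrable M K"
    and bound: "\<And>h r. \<bar>h\<bar> < \<delta> \<Longrightarrow> r \<in> space M \<Longrightarrow> \<bar>u (t + h) r - u t r - h * v r\<bar> \<le> h\<^sup>2 * K r"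
  shows "((\<lambda>s. \<integral>r. u s r \<partial>M) has_real_derivative (\<integral>r. v r \<partial>M)) (at t)"
proof -
  define F where "F s = (\<integral>r. u s r \<partial>M)" for s
  define D where "D = (\<integral>r. v r \<partial>M)"
  define C where "C = (\<integral>r. K r \<partial>M)"
  have quad: "\<bar>F (t + h) - F t - h * D\<bar> \<le> h\<^sup>2 * C" if h: "\<bar>h\<bar> < \<delta>" for h
  proof -
    have *: "integrable M (u (t + h))" "integrable M (u t)"
      using h \<open>0 < \<delta>\<close> by (auto intro!: u)
    have "F (t + h) - F t - h * D = (\<integral>r. u (t + h) r - u t r - h * v r \<partial>M)"
      using * v by (simp add: F_def D_def)
    also have "norm \<dots> \<le> (\<integral>r. h\<^sup>2 * K r \<partial>M)"
    proof (rule order_trans[OF integral_norm_bound], rule Bochner_Integration.integral_mono)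
      show "integrable M (\<lambda>r. norm (u (t + h) r - u t r - h * v r))" "integrable M (\<lambda>r. h\<^sup>2 * K r)"
        using * v K by auto
    qed (simp add: bound h)
    finally show ?thesis
      by (simp add: C_def)
  qed
  have "(\<lambda>h. (F (t + h) - F t) / h - D) \<midarrow>0\<rightarrow> 0"
  proof (rule Lim_null_comparison)
    have "\<forall>\<^sub>F h in at 0. h \<in> {-\<delta><..<\<delta>} - {0}"
      using \<open>0 < \<delta>\<close> by (intro eventually_at_in_open) auto
    thus "\<forall>\<^sub>F h in at 0. norm ((F (t + h) - F t) / h - D) \<le> \<bar>h\<bar> * C"
    proof eventually_elim
      case (elim h)
      hence "(F (t + h) - F t) / h - D = (F (t + h) - F t - h * D) / h"
        by (simp add: field_simps)
      also have "norm \<dots> \<le> h\<^sup>2 * C / \<bar>h\<bar>"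
        using quad[of h] elim by (auto simp: abs_divide intro!: divide_right_mono)
      also have "\<dots> = \<bar>h\<bar> * C"
        using elim by (cases "0 < h") (simp_all add: power2_eq_square)
      finally show ?case .
    qed
    have "isCont (\<lambda>h. \<bar>h\<bar> * C) 0"
      by (intro continuous_intros)
    thus "(\<lambda>h. \<bar>h\<bar> * C) \<midarrow>0\<rightarrow> 0"
      by (simp add: isCont_def)
  qed
  hence "(F has_real_derivative D) (at t)"
    by (simp add: DERIV_def LIM_zero_iff)
  thus ?thesis
    by (simp add: F_def[abs_def] D_def)
qed

text \<open>Restricting |h| to half of t costs at most half of the exponential decay, so the
  second-order remainder keeps the factor exp (-r t / 2) uniformly in h.\<close>

lemma exp_minus_taylor_bound:
  fixes r t h :: real
  assumes "0 \<le> r" "\<bar>h\<bar> \<le> t / 2"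
  shows "\<bar>exp (- r * (t + h)) - exp (- r * t) + h * r * exp (- r * t)\<bar> \<le>
      h\<^sup>2 * (r\<^sup>2 * exp (- r * (t / 2)))"
proof -
  \<comment> \<open>Lagrange remainder of order 2; the intermediate point satisfies |s| \<le> r |h|
    \<le> r t / 2.\<close>
  obtain s where s: "\<bar>s\<bar> \<le> \<bar>- r * h\<bar>"
      "exp (- r * h) = (\<Sum>m<2. (- r * h) ^ m / fact m) + exp s / fact 2 * (- r * h) ^ 2"
    using Maclaurin_exp_le[of "- r * h" 2] by blast
  have "exp (- r * (t + h)) - exp (- r * t) + h * r * exp (- r * t) =
      exp (- r * t) * (exp (- r * h) - 1 + r * h)"
    by (simp add: algebra_simps flip: exp_add)
  also have "\<dots> = exp (- r * t) * exp s / 2 * (h\<^sup>2 * r\<^sup>2)"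
    unfolding s(2) by (simp add: numeral_2_eq_2 algebra_simps)
  also have "\<dots> = exp (s - r * t) / 2 * (h\<^sup>2 * r\<^sup>2)"
    by (simp flip: exp_add)
  finally have eq: "exp (- r * (t + h)) - exp (- r * t) + h * r * exp (- r * t) =
      exp (s - r * t) / 2 * (h\<^sup>2 * r\<^sup>2)" .
  have "s \<le> r * (t / 2)"
    using s(1) mult_left_mono[OF assms(2,1)] assms(1) by (simp add: abs_mult)
  hence "exp (s - r * t) \<le> exp (- r * (t / 2))"
    by simp
  hence "exp (s - r * t) / 2 \<le> exp (- r * (t / 2))"
    using exp_gt_zero[of "s - r * t"] by linarith
  from mult_right_mono[OF this, of "h\<^sup>2 * r\<^sup>2"] show ?thesis
    unfolding eq by (simp add: abs_mult mult_ac)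
qed

section \<open>Comparison with the weight 1 / (1 + r)\<close>

lemma power_times_exp_minus_bound:
  assumes "0 < t"
  shows "\<exists>C\<ge>0. \<forall>r>0. r ^ n * exp (- r * t) \<le> C * (1 / (1 + r :: real))"
  using assms
proof (induction n arbitrary: t)
  case 0
  have "exp (- r * t) \<le> (1 + 1 / t) * (1 / (1 + r))" if "0 < r" for r
  proof -
    \<comment> \<open>The product expands to 1 + r + r t + 1 / t, which explains the constant 1 + 1
      / t.\<close>
    have "1 + r \<le> (1 + 1 / t) * (1 + r * t)"
      using that 0 by (simp add: field_simps)
    also have "\<dots> \<le> (1 + 1 / t) * exp (r * t)"
      using 0 by (intro mult_left_mono exp_ge_add_one_self) auto
    finally show ?thesis
      using that by (simp add: field_simps exp_minus)
  qed
  thus ?case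
    using 0 by (intro exI[of _ "1 + 1 / t"]) auto
next
  case (Suc n)
  then obtain C where C: "C \<ge> 0" "\<And>r. r > 0 \<Longrightarrow> r ^ n * exp (- r * (t / 2)) \<le> C * (1 / (1 + r))"
    using Suc.IH[of "t / 2"] by auto
  \<comment> \<open>The exponential is split into halves: one absorbs a factor r at the cost 2 / t,
    the other goes to the induction hypothesis at t / 2. Hence t varies in the induction.\<close>
  have "r ^ Suc n * exp (- r * t) \<le> (2 / t * C) * (1 / (1 + r))" if "0 < r" for r
  proof -
    have "r * (t / 2) \<le> exp (r * (t / 2))"
      using exp_ge_add_one_self[of "r * (t / 2)"] by linarith
    hence le: "r * exp (- r * (t / 2)) \<le> 2 / t"
      using Suc.prems by (simp add: exp_minus field_simps)
    have "r ^ Suc n * exp (- r * t) = (r * exp (- r * (t / 2))) * (r ^ n * exp (- r * (t / 2)))"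
      by (simp add: algebra_simps flip: exp_add)
    also have "\<dots> \<le> (2 / t) * (C * (1 / (1 + r)))"
      using that Suc.prems C(1) by (intro mult_mono le C(2)) auto
    finally show ?thesis
      by simp
  qed
  thus ?case
    using C(1) Suc.prems by (intro exI[of _ "2 / t * C"]) auto
qed

lemma one_minus_exp_div_bound:
  fixes r t :: real
  assumes "0 < r" "0 \<le> t"
  shows "(1 - exp (- t * r)) / r \<le> (1 + t) * (1 / (1 + r))"
proof -
  \<comment> \<open>Two estimates of 1 - exp (-t r) are added: at most t r for the summand 1 of 1 +
    r, and at most 1 for the summand r.\<close>
  have "(1 - exp (- t * r)) + (1 - exp (- t * r)) * r \<le> t * r + 1 * r"
    using assms exp_ge_add_one_self[of "- t * r"] by (intro add_mono mult_right_mono) auto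
  thus ?thesis
    using assms by (simp add: field_simps)
qed

text \<open>Clearing denominators reduces this to 1 + r \<le> (1 + 1 / x) (x + r) = 1 + r + x + r /
  x.\<close>

lemma inverse_add_bound:
  fixes x r :: real
  assumes "0 < x" "0 < r"
  shows "1 / (x + r) \<le> (1 + 1 / x) * (1 / (1 + r))"
  using add_pos_pos[OF assms(1) mult_pos_pos[OF assms(2,1)]] assms zero_le_square[of x]
  by (simp add: field_simps)

text \<open>\<open>deriv\<close> is iterated on total functions while the formulas hold only for t >
  0. A derivative at t > 0 sees only a neighbourhood inside (0, \<infinity>), so agreement with the
  family \<open>m\<close> passes from each order to the next.\<close>

lemma completely_monotonicI:
  assumes f: "\<And>t. 0 < t \<Longrightarrow> f t = m 0 t"
    and m: "\<And>n t. 0 < t \<Longrightarrow> (m n has_real_derivative m (Suc n) t) (at t)"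
    and sign: "\<And>n t. 0 < t \<Longrightarrow> 0 \<le> (- 1) ^ n * m n t"
  shows "completely_monotonic f"
proof -
  have transfer: "(g has_real_derivative m (Suc n) t) (at t)"
    if "\<And>s. 0 < s \<Longrightarrow> g s = m n s" "0 < t" for g n t
    by (rule has_field_derivative_transform_within_open[OF m open_greaterThan[of 0]])
       (use that in auto)
  have eq: "(deriv ^^ n) f t = m n t" if "0 < t" for n t
    using that
  proof (induction n arbitrary: t)
    case (Suc n)
    thus ?case
      using DERIV_imp_deriv[OF transfer[OF Suc.IH]] by simp
  qed (simp add: f)
  show ?thesis
    unfolding completely_monotonic_def
  proof (intro allI impI conjI)
    fix n and t :: real assume t: "0 < t"
    show "(deriv ^^ n) f field_differentiable at t"
      using transfer[OF eq t] field_differentiable_def by blast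
    show "0 \<le> (- 1) ^ n * (deriv ^^ n) f t"
      using sign[OF t] by (simp add: eq[OF t])
  qed
qed

section \<open>The spectral measure\<close>

locale stieltjes_spectral_measure =
  fixes \<nu> :: "real measure"
  assumes sets_eq: "sets \<nu> = sets (restrict_space borel {0<..})"
    and weight_finite: "(\<integral>\<^sup>+ r. ennreal (1 / (1 + r)) \<partial>\<nu>) < \<infinity>"
begin

lemma space_eq: "space \<nu> = {0<..}"
  using sets_eq_imp_space_eq[OF sets_eq] by (simp add: space_restrict_space)

lemma borel_measurable_spectral: "f \<in> borel_measurable borel \<Longrightarrow> f \<in> borel_measurable \<nu>"
  by (subst measurable_cong_sets[OF sets_eq refl]) (rule measurable_restrict_space1)

lemma integrable_weight: "integrable \<nu> (\<lambda>r. 1 / (1 + r))"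
proof (rule integrableI_bounded)
  show "(\<lambda>r. 1 / (1 + r)) \<in> borel_measurable \<nu>"
    by (intro borel_measurable_spectral) measurable
  have "(\<integral>\<^sup>+ r. ennreal (norm (1 / (1 + r))) \<partial>\<nu>) = (\<integral>\<^sup>+ r. ennreal (1 / (1 + r)) \<partial>\<nu>)"
    by (intro nn_integral_cong) (simp add: space_eq)
  thus "(\<integral>\<^sup>+ r. ennreal (norm (1 / (1 + r))) \<partial>\<nu>) < \<infinity>"
    using weight_finite by simp
qed

text \<open>The space of \<nu> is (0, \<infinity>), so the comparison is asked only for r > 0, while
  measurability can be checked on the whole line.\<close>

lemma integrable_dominated:
  fixes f :: "real \<Rightarrow> 'b :: {banach, second_countable_topology}"
  assumes "f \<in> borel_measurable borel"
    and "\<And>r. 0 < r \<Longrightarrow> norm (f r) \<le> C * (1 / (1 + r))"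
  shows "integrable \<nu> f"
proof (rule Bochner_Integration.integrable_bound)
  show "integrable \<nu> (\<lambda>r. C * (1 / (1 + r)))"
    by (intro integrable_mult_right integrable_weight)
  show "AE r in \<nu>. norm (f r) \<le> norm (C * (1 / (1 + r)))"
  proof (rule AE_I2)
    fix r assume "r \<in> space \<nu>"
    thus "norm (f r) \<le> norm (C * (1 / (1 + r)))"
      using order_trans[OF assms(2) abs_ge_self] by (simp add: space_eq)
  qed
qed (intro borel_measurable_spectral assms)

sublocale sigma_finite_measure \<nu>
proof
  \<comment> \<open>On (0, n] the weight is at least 1 / (n + 1), so these sets have finite mass,
    and they exhaust the space. Fubini rests on this sigma-finiteness.\<close>
  define A where "A n = {0<..real n}" for n
  have A: "A n \<inter> space \<nu> \<in> sets \<nu> \<and> emeasure \<nu> (A n \<inter> space \<nu>) < \<infinity>" for n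
  proof -
    have "integrable \<nu> (indicator (A n) :: real \<Rightarrow> real)"
    proof (rule integrable_dominated)
      show "indicator (A n) \<in> borel_measurable borel"
        by (simp add: A_def)
      show "norm (indicator (A n) r :: real) \<le> real (n + 1) * (1 / (1 + r))" if "0 < r" for r
        using that by (auto simp: A_def indicator_def field_simps)
    qed
    thus ?thesis
      by (simp add: integrable_indicator_iff)
  qed
  have "A n \<inter> space \<nu> = A n" for n
    by (auto simp: A_def space_eq)
  hence "A n \<in> sets \<nu>" "emeasure \<nu> (A n) \<noteq> \<infinity>" for n
    using A[of n] by (simp_all add: less_top)
  moreover have "\<Union>(range A) = space \<nu>"
    by (auto simp: A_def space_eq real_arch_simple)
  ultimately show "\<exists>A. countable A \<and> A \<subseteq> sets \<nu> \<and> \<Union>A = space \<nu> \<and> (\<forall>a\<in>A. emeasure \<nu> a \<noteq> \<infinity>)"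
    by (intro exI[of _ "range A"]) auto
qed

sublocale pair: pair_sigma_finite \<nu> lborel ..

text \<open>Fubini for \<nu> against Lebesgue measure. Measurability is asked on the Borel product
  and pulled back along the inclusion of (0, \<infinity>) into the line; the iterated integral of
  norms supplies joint integrability.\<close>

lemma
  fixes u :: "real \<Rightarrow> real \<Rightarrow> 'b :: {banach, second_countable_topology}"
  assumes meas: "(\<lambda>(r, t). u r t) \<in> borel_measurable (borel \<Otimes>\<^sub>M borel)"
    and int: "\<And>r. 0 < r \<Longrightarrow> integrable lborel (u r)"
    and int_norm: "integrable \<nu> (\<lambda>r. \<integral>t. norm (u r t) \<partial>lborel)"
  shows integrable_spectral_integral: "integrable lborel (\<lambda>t. \<integral>r. u r t \<partial>\<nu>)"
    and integral_spectral_swap: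
      "(\<integral>t. (\<integral>r. u r t \<partial>\<nu>) \<partial>lborel) = (\<integral>r. (\<integral>t. u r t \<partial>lborel) \<partial>\<nu>)"
proof -
  have "fst \<in> \<nu> \<Otimes>\<^sub>M lborel \<rightarrow>\<^sub>M borel"
    using measurable_compose[OF measurable_fst borel_measurable_spectral[of "\<lambda>x. x"]] by simp
  moreover have "snd \<in> \<nu> \<Otimes>\<^sub>M lborel \<rightarrow>\<^sub>M borel"
    by measurable
  ultimately have "(\<lambda>x. (fst x, snd x)) \<in> \<nu> \<Otimes>\<^sub>M lborel \<rightarrow>\<^sub>M borel \<Otimes>\<^sub>M borel"
    by (rule measurable_Pair)
  from measurable_compose[OF this meas]
  have "(\<lambda>(r, t). u r t) \<in> borel_measurable (\<nu> \<Otimes>\<^sub>M lborel)"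
    by (simp add: case_prod_unfold)
  hence "integrable (\<nu> \<Otimes>\<^sub>M lborel) (\<lambda>(r, t). u r t)"
    using int int_norm by (intro pair.Fubini_integrable) (auto simp: space_eq intro!: AE_I2)
  thus "integrable lborel (\<lambda>t. \<integral>r. u r t \<partial>\<nu>)"
    and "(\<integral>t. (\<integral>r. u r t \<partial>\<nu>) \<partial>lborel) = (\<integral>r. (\<integral>t. u r t \<partial>lborel) \<partial>\<nu>)"
    by (rule pair.integrable_snd, rule pair.Fubini_integral)
qed

section \<open>Moments of \<nu> and complete monotonicity of g\<close>

lemma integrable_power_times_exp:
  assumes "0 < t"
  shows "integrable \<nu> (\<lambda>r. r ^ n * exp (- r * t))"
proof -
  obtain C where C: "\<And>r. r > 0 \<Longrightarrow> r ^ n * exp (- r * t) \<le> C * (1 / (1 + r))"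
    using power_times_exp_minus_bound[OF assms] by blast
  show ?thesis
  proof (rule integrable_dominated)
    show "norm (r ^ n * exp (- r * t)) \<le> C * (1 / (1 + r))" if "0 < r" for r
      using C[OF that] that by simp
  qed measurable
qed

lemma integrable_exp: "0 < t \<Longrightarrow> integrable \<nu> (\<lambda>r. exp (- r * t))"
  using integrable_power_times_exp[of t 0] by simp

text \<open>The n-th derivative of \<open>g_fun \<nu>\<close> at t > 0, as obtained by formal
  differentiation under the integral; the powers of \<open>- r\<close> carry the alternating
  sign.\<close>

definition moment :: "nat \<Rightarrow> real \<Rightarrow> real" where
  "moment n t = (\<integral>r. (- r) ^ n * exp (- r * t) \<partial>\<nu>)"

lemma integrable_moment:
  assumes "0 < t"
  shows "integrable \<nu> (\<lambda>r. (- r) ^ n * exp (- r * t))"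
proof -
  have eq: "(- r) ^ n * exp (- r * t) = (- 1) ^ n * (r ^ n * exp (- r * t))" for r :: real
    by (simp only: power_minus[of r n] mult.assoc)
  show ?thesis
    unfolding eq by (intro integrable_mult_right integrable_power_times_exp assms)
qed

lemma moment_has_derivative:
  assumes "0 < t"
  shows "(moment n has_real_derivative moment (Suc n) t) (at t)"
  unfolding moment_def[abs_def]
proof (rule has_real_derivative_integral)
  show "0 < t / 2"
    using assms by simp
  show "integrable \<nu> (\<lambda>r. (- r) ^ n * exp (- r * s))" if "\<bar>s - t\<bar> < t / 2" for s
    by (rule integrable_moment) (use that assms in linarith)
  show "integrable \<nu> (\<lambda>r. (- r) ^ Suc n * exp (- r * t))"
    by (rule integrable_moment[OF assms])
  \<comment> \<open>Remainder coefficient: n powers of r come from the moment, two from the Taylor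
    bound, and half of the decay survives.\<close>
  show "integrable \<nu> (\<lambda>r. r ^ (n + 2) * exp (- r * (t / 2)))"
    by (rule integrable_power_times_exp) (use assms in simp)
next
  fix h r :: real assume h: "\<bar>h\<bar> < t / 2" and "r \<in> space \<nu>"
  hence r: "0 < r"
    by (simp add: space_eq)
  have "(- r) ^ n * exp (- r * (t + h)) - (- r) ^ n * exp (- r * t)
      - h * ((- r) ^ Suc n * exp (- r * t)) =
      (- r) ^ n * (exp (- r * (t + h)) - exp (- r * t) + h * r * exp (- r * t))"
    by (simp add: algebra_simps)
  also have "\<bar>\<dots>\<bar> = r ^ n * \<bar>exp (- r * (t + h)) - exp (- r * t) + h * r * exp (- r * t)\<bar>"
    using r by (simp add: abs_mult power_abs)
  also have "\<dots> \<le> r ^ n * (h\<^sup>2 * (r\<^sup>2 * exp (- r * (t / 2))))"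
    using r h by (intro mult_left_mono exp_minus_taylor_bound) auto
  also have "\<dots> = h\<^sup>2 * (r ^ (n + 2) * exp (- r * (t / 2)))"
    by (simp only: power_add mult_ac)
  finally show "\<bar>(- r) ^ n * exp (- r * (t + h)) - (- r) ^ n * exp (- r * t)
      - h * ((- r) ^ Suc n * exp (- r * t))\<bar> \<le> h\<^sup>2 * (r ^ (n + 2) * exp (- r * (t / 2)))" .
qed

lemma moment_sign: "0 \<le> (- 1) ^ n * moment n t"
proof -
  have "(- 1) ^ n * moment n t = (\<integral>r. (- 1) ^ n * ((- r) ^ n * exp (- r * t)) \<partial>\<nu>)"
    by (simp add: moment_def)
  also have "0 \<le> \<dots>"
    by (intro Bochner_Integration.integral_nonneg)
       (simp add: space_eq flip: mult.assoc power_mult_distrib)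
  finally show ?thesis .
qed

lemma g_fun_eq_moment: "g_fun \<nu> t = moment 0 t"
  by (simp add: g_fun_def moment_def)

text \<open>Agreement on (0, \<infinity>) suffices, so one statement covers both
  \<open>g_fun\<close> itself and the derivative of \<open>f_fun\<close>.\<close>

lemma completely_monotonic_if_eq_g_fun:
  "(\<And>t. 0 < t \<Longrightarrow> g t = g_fun \<nu> t) \<Longrightarrow> completely_monotonic g"
  by (rule completely_monotonicI[of _ moment])
     (simp_all add: g_fun_eq_moment moment_has_derivative moment_sign)

section \<open>The primitive f: kernel formula, derivative and continuity\<close>

lemma integrable_one_minus_exp_div:
  assumes "0 \<le> t"
  shows "integrable \<nu> (\<lambda>r. (1 - exp (- t * r)) / r)"
proof (rule integrable_dominated)
  show "norm ((1 - exp (- t * r)) / r) \<le> (1 + t) * (1 / (1 + r))" if "0 < r" for r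
    using one_minus_exp_div_bound[OF that assms] assms that by simp
qed measurable

text \<open>Integrating exp (-r t) over (0, T] first gives the kernel of f. The integrand is
  nonnegative, so this same integral already provides the absolute integrability that Fubini asks
  for.\<close>

lemma
  assumes "0 \<le> T"
  shows integrable_g_fun_Ioc: "set_integrable lborel {0<..T} (g_fun \<nu>)"
    and integral_g_fun_Ioc:
      "(\<integral>t\<in>{0<..T}. g_fun \<nu> t \<partial>lborel) = (\<integral>r. (1 - exp (- T * r)) / r \<partial>\<nu>)"
proof -
  define u :: "real \<Rightarrow> real \<Rightarrow> real" where "u r t = indicator {0<..T} t * exp (- r * t)" for r t
  have u_int: "integrable lborel (u r)"
    and u_eq: "(\<integral>t. u r t \<partial>lborel) = (1 - exp (- T * r)) / r" if "0 < r" for r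
    using set_lborel_exp_Ioc[OF that assms] unfolding u_def set_integrable_def set_lebesgue_integral_def
    by simp_all
  have meas: "(\<lambda>(r, t). u r t) \<in> borel_measurable (borel \<Otimes>\<^sub>M borel)"
    unfolding u_def by measurable
  have "(\<lambda>t. norm (u r t)) = u r" for r
    by (auto simp: u_def indicator_def)
  hence "integrable \<nu> (\<lambda>r. \<integral>t. norm (u r t) \<partial>lborel) \<longleftrightarrow>
      integrable \<nu> (\<lambda>r. (1 - exp (- T * r)) / r)"
    by (intro Bochner_Integration.integrable_cong refl) (simp add: space_eq u_eq)
  hence norm_int: "integrable \<nu> (\<lambda>r. \<integral>t. norm (u r t) \<partial>lborel)"
    using integrable_one_minus_exp_div[OF assms] by simp
  have eq: "(\<integral>r. u r t \<partial>\<nu>) = indicator {0<..T} t *\<^sub>R g_fun \<nu> t" for t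
    by (simp add: u_def g_fun_def)
  show "set_integrable lborel {0<..T} (g_fun \<nu>)"
    using integrable_spectral_integral[OF meas u_int norm_int]
    unfolding eq set_integrable_def .
  have "(\<integral>t\<in>{0<..T}. g_fun \<nu> t \<partial>lborel) = (\<integral>r. (\<integral>t. u r t \<partial>lborel) \<partial>\<nu>)"
    using integral_spectral_swap[OF meas u_int norm_int]
    unfolding eq set_lebesgue_integral_def .
  also have "\<dots> = (\<integral>r. (1 - exp (- T * r)) / r \<partial>\<nu>)"
    by (intro Bochner_Integration.integral_cong refl) (simp add: space_eq u_eq)
  finally show "(\<integral>t\<in>{0<..T}. g_fun \<nu> t \<partial>lborel) = (\<integral>r. (1 - exp (- T * r)) / r \<partial>\<nu>)" .
qed

lemma f_fun_eq: "0 \<le> t \<Longrightarrow> f_fun \<nu> t = (\<integral>r. (1 - exp (- t * r)) / r \<partial>\<nu>)"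
  by (simp add: f_fun_def integral_g_fun_Ioc)

text \<open>The endpoint t = 0 is included because \<open>{0<..0}\<close> is empty.\<close>

lemma f_fun_eq_0: "t \<le> 0 \<Longrightarrow> f_fun \<nu> t = 0"
  by (simp add: f_fun_def set_lebesgue_integral_def)

lemma f_fun_nonneg: "0 \<le> f_fun \<nu> t"
proof (cases "0 \<le> t")
  case True
  show ?thesis
    unfolding f_fun_eq[OF True]
    by (intro Bochner_Integration.integral_nonneg) (use True in \<open>simp add: space_eq\<close>)
qed (simp add: f_fun_eq_0)

lemma f_fun_has_derivative:
  assumes "0 < t"
  shows "(f_fun \<nu> has_real_derivative g_fun \<nu> t) (at t)"
proof -
  have "((\<lambda>s. \<integral>r. (1 - exp (- s * r)) / r \<partial>\<nu>) has_real_derivative (\<integral>r. exp (- r * t) \<partial>\<nu>)) (at t)"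
  proof (rule has_real_derivative_integral)
    show "0 < t / 2"
      using assms by simp
    show "integrable \<nu> (\<lambda>r. (1 - exp (- s * r)) / r)" if "\<bar>s - t\<bar> < t / 2" for s
      by (rule integrable_one_minus_exp_div) (use that assms in linarith)
    show "integrable \<nu> (\<lambda>r. exp (- r * t))"
      by (rule integrable_exp[OF assms])
    show "integrable \<nu> (\<lambda>r. r ^ 1 * exp (- r * (t / 2)))"
      by (rule integrable_power_times_exp) (use assms in simp)
  next
    fix h r :: real assume h: "\<bar>h\<bar> < t / 2" and "r \<in> space \<nu>"
    hence r: "0 < r"
      by (simp add: space_eq)
    \<comment> \<open>The increment of the kernel is minus that of exp (-r t), divided by r, so the
      same Taylor bound applies; dividing r^2 by r leaves the single power in the majorant.\<close>
    have "(1 - exp (- (t + h) * r)) / r - (1 - exp (- t * r)) / r - h * exp (- r * t) =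
        - (exp (- r * (t + h)) - exp (- r * t) + h * r * exp (- r * t)) / r"
      using r by (simp add: field_simps)
    also have "\<bar>\<dots>\<bar> = \<bar>exp (- r * (t + h)) - exp (- r * t) + h * r * exp (- r * t)\<bar> / r"
      using r by (simp only: abs_divide abs_minus_cancel)
    also have "\<dots> \<le> h\<^sup>2 * (r\<^sup>2 * exp (- r * (t / 2))) / r"
      using r h by (intro divide_right_mono exp_minus_taylor_bound) auto
    also have "\<dots> = h\<^sup>2 * (r ^ 1 * exp (- r * (t / 2)))"
      using r by (simp add: power2_eq_square)
    finally show "\<bar>(1 - exp (- (t + h) * r)) / r - (1 - exp (- t * r)) / r - h * exp (- r * t)\<bar>
        \<le> h\<^sup>2 * (r ^ 1 * exp (- r * (t / 2)))" .
  qed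
  from has_field_derivative_transform_within_open[OF this open_greaterThan[of 0], of "f_fun \<nu>"]
  show ?thesis
    using assms by (simp add: f_fun_eq g_fun_def)
qed

lemma bernstein_f_fun: "bernstein (f_fun \<nu>)"
  unfolding bernstein_def
proof (intro conjI allI impI)
  show "f_fun \<nu> field_differentiable at t" if "0 < t" for t
    using f_fun_has_derivative[OF that] field_differentiable_def by blast
  show "completely_monotonic (deriv (f_fun \<nu>))"
    by (rule completely_monotonic_if_eq_g_fun) (rule DERIV_imp_deriv[OF f_fun_has_derivative])
qed (rule f_fun_nonneg)

text \<open>Sequential continuity suits dominated convergence: a convergent sequence has an upper
  bound \<open>B\<close>, and (1 + B) / (1 + r) then majorizes all kernels at once, also when the
  limit is the endpoint 0.\<close>

lemma continuous_on_f_fun_Ici: "continuous_on {0..} (f_fun \<nu>)"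
  unfolding continuous_on_sequentially
proof (intro allI ballI impI)
  fix X :: "nat \<Rightarrow> real" and a :: real
  assume "a \<in> {0..}" and X: "(\<forall>n. X n \<in> {0..}) \<and> X \<longlonglongrightarrow> a"
  then obtain B where B: "\<And>n. X n \<le> B"
    using convergent_imp_Bseq convergentI
    by (metis abs_le_D1 BseqE real_norm_def)
  have "(\<lambda>n. \<integral>r. (1 - exp (- X n * r)) / r \<partial>\<nu>) \<longlonglongrightarrow> (\<integral>r. (1 - exp (- a * r)) / r \<partial>\<nu>)"
  proof (rule integral_dominated_convergence)
    show "integrable \<nu> (\<lambda>r. (1 + B) * (1 / (1 + r)))"
      using integrable_weight by (rule integrable_mult_right)
    show "AE r in \<nu>. (\<lambda>n. (1 - exp (- X n * r)) / r) \<longlonglongrightarrow> (1 - exp (- a * r)) / r"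
      using X by (auto simp: space_eq intro!: AE_I2 tendsto_intros)
    show "AE r in \<nu>. norm ((1 - exp (- X n * r)) / r) \<le> (1 + B) * (1 / (1 + r))" for n
    proof (rule AE_I2)
      fix r assume "r \<in> space \<nu>"
      hence r: "0 < r"
        by (simp add: space_eq)
      have "norm ((1 - exp (- X n * r)) / r) = (1 - exp (- X n * r)) / r"
        using X r by simp
      also have "\<dots> \<le> (1 + X n) * (1 / (1 + r))"
        using X r by (intro one_minus_exp_div_bound) auto
      also have "\<dots> \<le> (1 + B) * (1 / (1 + r))"
        using B[of n] r by (intro mult_right_mono) auto
      finally show "norm ((1 - exp (- X n * r)) / r) \<le> (1 + B) * (1 / (1 + r))" .
    qed
  qed (intro borel_measurable_spectral; measurable)+
  thus "(f_fun \<nu> \<circ> X) \<longlonglongrightarrow> f_fun \<nu> a"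
    using X \<open>a \<in> {0..}\<close> by (simp add: comp_def f_fun_eq)
qed

lemma continuous_on_f_fun: "continuous_on UNIV (f_fun \<nu>)"
proof -
  have "continuous_on {..0} (f_fun \<nu>) \<longleftrightarrow> continuous_on {..0::real} (\<lambda>_. 0::real)"
    by (rule continuous_on_cong) (simp_all add: f_fun_eq_0)
  hence "continuous_on ({..0} \<union> {0..}) (f_fun \<nu>)"
    by (intro continuous_on_closed_Un continuous_on_f_fun_Ici) auto
  also have "{..0} \<union> {0..} = (UNIV :: real set)"
    by auto
  finally show ?thesis .
qed

section \<open>Laplace integral of f\<close>

lemma integrable_inverse_add:
  assumes "0 < Re p"
  shows "integrable \<nu> (\<lambda>r. 1 / (p + of_real r))"
proof (rule integrable_dominated)
  show "norm (1 / (p + of_real r)) \<le> (1 + 1 / Re p) * (1 / (1 + r))" if "0 < r" for r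
  proof -
    have "norm (1 / (p + of_real r)) \<le> 1 / (Re p + r)"
      using assms that complex_Re_le_cmod[of "p + of_real r"]
      by (simp add: norm_divide divide_left_mono frac_le)
    also have "\<dots> \<le> (1 + 1 / Re p) * (1 / (1 + r))"
      by (rule inverse_add_bound[OF assms that])
    finally show ?thesis .
  qed
qed measurable

text \<open>The integrability half is used again at real p, where it supplies the integrable weight
  of the tempered extension.\<close>

lemma
  assumes p: "0 < Re p"
  shows integrable_f_fun_exp: "integrable lborel (\<lambda>t. of_real (f_fun \<nu> t) * exp (- p * of_real t))"
    and laplace_f_fun: "p\<^sup>2 * (\<integral>t. of_real (f_fun \<nu> t) * exp (- p * of_real t) \<partial>lborel) =
      disp_atten_fun \<nu> p"
proof -
  define u :: "real \<Rightarrow> real \<Rightarrow> complex" where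
    "u r t = indicator {0<..} t * (of_real ((1 - exp (- t * r)) / r) * exp (- p * of_real t))" for r t
  \<comment> \<open>With the indicators kept, the splitting into exponentials of rates p and p + r
    holds for every t, and each piece is integrable on its own.\<close>
  have u_split: "u r t = of_real (1 / r) * (indicator {0<..} t *\<^sub>R exp (- p * of_real t) -
      indicator {0<..} t *\<^sub>R exp (- (p + of_real r) * of_real t))" if "0 < r" for r t
  proof (cases "0 < t")
    case True
    have "exp (- (p + of_real r) * of_real t) = exp (- p * of_real t) * exp (of_real (- t * r))"
      by (simp add: algebra_simps flip: exp_add)
    also have "exp (of_real (- t * r)) = complex_of_real (exp (- t * r))"
      by (rule exp_of_real)
    finally show ?thesis
      using True by (simp only: u_def) (simp add: diff_divide_distrib algebra_simps)
  qed (simp add: u_def)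
  have u_int: "integrable lborel (u r)" if "0 < r" for r
    unfolding u_split[OF that, abs_def]
    using set_lborel_complex_exp_Ioi(1)[of p] set_lborel_complex_exp_Ioi(1)[of "p + of_real r"] p that
    unfolding set_integrable_def by (intro integrable_mult_right Bochner_Integration.integrable_diff) auto
  have u_eq: "(\<integral>t. u r t \<partial>lborel) = 1 / p * (1 / (p + of_real r))" if "0 < r" for r
  proof -
    have [simp]: "p \<noteq> 0" "p + of_real r \<noteq> 0"
      using p that by (auto simp: complex_eq_iff)
    have "(\<integral>t. u r t \<partial>lborel) = of_real (1 / r) * (1 / p - 1 / (p + of_real r))"
      unfolding u_split[OF that, abs_def]
      using set_lborel_complex_exp_Ioi[of p] set_lborel_complex_exp_Ioi[of "p + of_real r"] p that
      unfolding set_integrable_def set_lebesgue_integral_def by simp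
    also have "\<dots> = 1 / p * (1 / (p + of_real r))"
      using that by (simp add: divide_simps)
    finally show ?thesis .
  qed
  \<comment> \<open>The kernel is nonnegative, so taking norms merely replaces p by Re p; the result
    is dominated by the weight.\<close>
  have u_norm: "(\<integral>t. norm (u r t) \<partial>lborel) = 1 / Re p * (1 / (Re p + r))" if "0 < r" for r
  proof -
    have "norm (u r t) = 1 / r * (indicator {0<..} t *\<^sub>R exp (- Re p * t) -
        indicator {0<..} t *\<^sub>R exp (- (Re p + r) * t))" for t
    proof (cases "0 < t")
      case True
      have "norm (of_real ((1 - exp (- t * r)) / r) :: complex) = (1 - exp (- t * r)) / r"
        using True that unfolding norm_of_real by simp
      moreover have "exp (- (Re p + r) * t) = exp (- Re p * t) * exp (- t * r)"
        by (simp add: algebra_simps flip: exp_add)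
      moreover have "norm (exp (- p * of_real t)) = exp (- Re p * t)"
        by simp
      ultimately show ?thesis
        using True by (simp only: u_def norm_mult) (simp add: diff_divide_distrib algebra_simps)
    qed (simp add: u_def)
    hence "(\<integral>t. norm (u r t) \<partial>lborel) = 1 / r * (1 / Re p - 1 / (Re p + r))"
      using set_lborel_exp_Ioi[of "Re p"] set_lborel_exp_Ioi[of "Re p + r"] p that
      unfolding set_integrable_def set_lebesgue_integral_def by simp
    also have "\<dots> = 1 / Re p * (1 / (Re p + r))"
      using that p by (simp add: divide_simps)
    finally show ?thesis .
  qed
  have meas: "(\<lambda>(r, t). u r t) \<in> borel_measurable (borel \<Otimes>\<^sub>M borel)"
    unfolding u_def by measurable
  have "integrable \<nu> (\<lambda>r. \<integral>t. norm (u r t) \<partial>lborel) \<longleftrightarrow>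
      integrable \<nu> (\<lambda>r. 1 / Re p * (1 / (Re p + r)))"
    by (intro Bochner_Integration.integrable_cong refl) (simp add: space_eq u_norm)
  moreover have "integrable \<nu> (\<lambda>r. 1 / Re p * (1 / (Re p + r)))"
  proof (intro integrable_mult_right integrable_dominated)
    show "norm (1 / (Re p + r)) \<le> (1 + 1 / Re p) * (1 / (1 + r))" if "0 < r" for r
      using inverse_add_bound[OF p that] p that by simp
  qed measurable
  ultimately have norm_int: "integrable \<nu> (\<lambda>r. \<integral>t. norm (u r t) \<partial>lborel)"
    by (simp only:)
  have eq: "(\<integral>r. u r t \<partial>\<nu>) = of_real (f_fun \<nu> t) * exp (- p * of_real t)" for t
  proof (cases "0 < t")
    case True
    hence "u r t = of_real ((1 - exp (- t * r)) / r) * exp (- p * of_real t)" for r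
      by (simp add: u_def)
    hence "(\<integral>r. u r t \<partial>\<nu>) = (\<integral>r. of_real ((1 - exp (- t * r)) / r) \<partial>\<nu>) * exp (- p * of_real t)"
      by (simp only: integral_mult_left_zero)
    thus ?thesis
      using True by (simp only: integral_complex_of_real f_fun_eq less_imp_le)
  qed (simp add: u_def f_fun_eq_0)
  show "integrable lborel (\<lambda>t. of_real (f_fun \<nu> t) * exp (- p * of_real t))"
    using integrable_spectral_integral[OF meas u_int norm_int] unfolding eq .
  have "(\<integral>t. of_real (f_fun \<nu> t) * exp (- p * of_real t) \<partial>lborel) = (\<integral>r. (\<integral>t. u r t \<partial>lborel) \<partial>\<nu>)"
    using integral_spectral_swap[OF meas u_int norm_int] unfolding eq .
  also have "\<dots> = (\<integral>r. 1 / p * (1 / (p + of_real r)) \<partial>\<nu>)"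
    by (intro Bochner_Integration.integral_cong refl) (simp add: space_eq u_eq)
  also have "\<dots> = 1 / p * (\<integral>r. 1 / (p + of_real r) \<partial>\<nu>)"
    by (rule integral_mult_right_zero)
  finally show "p\<^sup>2 * (\<integral>t. of_real (f_fun \<nu> t) * exp (- p * of_real t) \<partial>lborel) = disp_atten_fun \<nu> p"
    by (simp add: disp_atten_fun_def power2_eq_square)
qed

end

theorem mainTheorem3:
  fixes \<rho> :: real and G :: "real \<Rightarrow> real" and \<nu> :: "real measure"
  assumes "0 < \<rho>"
    and "locally_integrable G" and "completely_monotonic G"
    and "0 < Lim at_top G"
    and "disp_atten_spectral_measure \<rho> G \<nu>"
  shows
    "(\<forall>t>0. integrable \<nu> (\<lambda>r. exp (- r * t))) \<and>
     locally_integrable (g_fun \<nu>) \<and> completely_monotonic (g_fun \<nu>) \<and>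
     (\<forall>t\<ge>0. integrable \<nu> (\<lambda>r. (1 - exp (- t * r)) / r) \<and>
            f_fun \<nu> t = (\<integral>r. (1 - exp (- t * r)) / r \<partial>\<nu>)) \<and>
     bernstein (f_fun \<nu>) \<and> continuous_on {0..} (f_fun \<nu>) \<and> f_fun \<nu> 0 = 0 \<and>
     is_distribution (distr_deriv (distr_deriv (regular_distr (f_fun \<nu>)))) \<and>
     causal (distr_deriv (distr_deriv (regular_distr (f_fun \<nu>)))) \<and>
     (\<forall>p. 0 < Re p \<longrightarrow>
        integrable \<nu> (\<lambda>r. 1 / (p + of_real r)) \<and>
        has_laplace_transform_at (distr_deriv (distr_deriv (regular_distr (f_fun \<nu>))))
          (disp_atten_fun \<nu> p) p)"
proof -
  interpret stieltjes_spectral_measure \<nu>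
    using assms(5) by unfold_locales (simp_all add: disp_atten_spectral_measure_def radon_on_pos_def)
  define T where "T = distr_deriv (distr_deriv (regular_distr (f_fun \<nu>)))"
  have laplace: "has_laplace_transform_at T (disp_atten_fun \<nu> p) p" if p: "0 < Re p" for p
  proof -
    \<comment> \<open>The choice \<sigma> = Re p / 2 lies strictly between 0 and Re p: positive for
      integrability, below Re p for the transform. Since f \<ge> 0, taking norms turns the complex
      integrand into the real one.\<close>
    have "integrable lborel
        (\<lambda>t. of_real (f_fun \<nu> t) * exp (- of_real (Re p / 2) * complex_of_real t))"
      using p by (intro integrable_f_fun_exp) simp
    hence "integrable lborel
        (\<lambda>t. norm (of_real (f_fun \<nu> t) * exp (- of_real (Re p / 2) * complex_of_real t)))"
      by (rule integrable_norm)
    moreover have "norm (of_real (f_fun \<nu> t) * exp (- of_real (Re p / 2) * complex_of_real t)) =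
        f_fun \<nu> t * exp (- (Re p / 2) * t)" for t
      by (simp add: norm_mult f_fun_nonneg)
    ultimately have "integrable lborel (\<lambda>t. f_fun \<nu> t * exp (- (Re p / 2) * t))"
      by (simp only:)
    from has_laplace_transform_at_second_derivative[OF continuous_on_f_fun f_fun_eq_0 _ this, of p]
    show ?thesis
      using p unfolding T_def laplace_f_fun[OF p] by simp
  qed
  \<comment> \<open>Both are conjuncts of having a Laplace transform at a point, so any p with
    positive real part, here 1, yields them.\<close>
  have "is_distribution T" "causal T"
    using laplace[of 1] by (simp_all add: has_laplace_transform_at_def)
  moreover have "locally_integrable (g_fun \<nu>)"
    unfolding locally_integrable_def by (rule integrable_g_fun_Ioc) simp
  moreover have "completely_monotonic (g_fun \<nu>)"
    by (rule completely_monotonic_if_eq_g_fun) simp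
  ultimately show ?thesis
    using integrable_exp integrable_one_minus_exp_div f_fun_eq bernstein_f_fun
      continuous_on_f_fun_Ici f_fun_eq_0[of 0] integrable_inverse_add laplace
    unfolding T_def[symmetric] by (intro conjI allI impI) simp_all
qed

end
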